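(* Let $C$ be a self-dual $L$-code of length $n$. Then there is a polynomial $F(X_1,X_2,X_3)$, weighted homogeneous of weighted degree $n$ with respect to the weights $1,1,2$ of $X_1,X_2,X_3$, such that $$\mathrm{swe}_C(x,y,z)=F\bigl(x+y,\ x+z,\ x^2+y^2+2z^2\bigr).$$
   Context: Let $L=\{0,1,\omega,\bar\omega\}$ be the Klein four-group $\mathbf{Z}_2\times\mathbf{Z}_2$, with dot product $x\cdot y\in\mathbf{F}_2$ equal to $1$ iff $x,y$ are distinct and both nonzero, $0$ otherwise. On $L^n$: $(\mathbf{x},\mathbf{y})=\sum_i x_i\cdot y_i$. An $L$-code of length $n$ is a subgroup $C\subseteq L^n$; it is self-dual if $C=\{\mathbf{x}:(\mathbf{x},\mathbf{y})=0\ \forall\mathbf{y}\in C\}$. The symmetrized weight enumerator is $\mathrm{swe}_C(x,y,z)=\sum_{\mathbf{c}\in C}x^{n_0(\mathbf{c})}y^{n_1(\mathbf{c})}z^{n_2(\mathbf{c})}$, with $n_0,n_1,n_2$ the numbers of coordinates equal to $0$, to $1$, and to $\omega$ or $\bar\omega$. *)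

theory Defs
  imports
    "HOL-Algebra.Product_Groups"
    "HOL-Library.Poly_Mapping"
    "HOL-Library.Numeral_Type"
    "HOL-Library.Z2"
begin

datatype klein = Zero | One | Omega | OmegaBar

fun klein_add :: "klein \<Rightarrow> klein \<Rightarrow> klein" where
  "klein_add Zero y = y"
| "klein_add x Zero = x"
| "klein_add One One = Zero"
| "klein_add One Omega = OmegaBar"
| "klein_add One OmegaBar = Omega"
| "klein_add Omega One = OmegaBar"
| "klein_add Omega Omega = Zero"
| "klein_add Omega OmegaBar = One"
| "klein_add OmegaBar One = Omega"
| "klein_add OmegaBar Omega = One"
| "klein_add OmegaBar OmegaBar = Zero"

definition klein_group :: "klein monoid" where
  "klein_group = \<lparr>carrier = UNIV, mult = klein_add, one = Zero\<rparr>"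

lemma comm_group_klein_group: "comm_group klein_group"
proof (rule comm_groupI)
  fix x y z
  show "x \<otimes>\<^bsub>klein_group\<^esub> y \<otimes>\<^bsub>klein_group\<^esub> z
      = x \<otimes>\<^bsub>klein_group\<^esub> (y \<otimes>\<^bsub>klein_group\<^esub> z)"
    by (cases x; cases y; cases z) (simp_all add: klein_group_def)
  show "x \<otimes>\<^bsub>klein_group\<^esub> y = y \<otimes>\<^bsub>klein_group\<^esub> x"
    by (cases x; cases y) (simp_all add: klein_group_def)
  show "\<exists>y \<in> carrier klein_group. y \<otimes>\<^bsub>klein_group\<^esub> x = \<one>\<^bsub>klein_group\<^esub>"
    by (rule bexI[of _ x]; cases x) (simp_all add: klein_group_def)
qed (simp_all add: klein_group_def)

lemma klein_group_iso: "klein_group \<cong> integer_mod_group 2 \<times>\<times> integer_mod_group 2"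
proof -
  define h :: "klein \<Rightarrow> int \<times> int" where
    "h = case_klein (0, 0) (1, 1) (1, 0) (0, 1)"
  have carr: "carrier (integer_mod_group 2) = {0, 1}"
    by (auto simp: carrier_integer_mod_group)
  have mlt: "a \<otimes>\<^bsub>integer_mod_group 2\<^esub> b = (a + b) mod 2" for a b
    by (simp add: integer_mod_group_def)
  have h: "h x \<in> {0, 1} \<times> {0, 1}" for x
    by (cases x) (simp_all add: h_def)
  have "h \<in> hom klein_group (integer_mod_group 2 \<times>\<times> integer_mod_group 2)"
  proof (rule homI)
    fix x y
    show "h (x \<otimes>\<^bsub>klein_group\<^esub> y)
        = h x \<otimes>\<^bsub>integer_mod_group 2 \<times>\<times> integer_mod_group 2\<^esub> h y"
      by (cases x; cases y) (simp_all add: h_def klein_group_def mult_DirProd mlt)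
  qed (use h in \<open>simp add: carr\<close>)
  moreover have "inj h"
  proof (rule injI)
    fix x y assume "h x = h y"
    then show "x = y" by (cases x; cases y) (simp_all add: h_def)
  qed
  moreover have "h ` UNIV = {0, 1} \<times> {0, 1}"
  proof
    show "{0, 1} \<times> {0, 1} \<subseteq> range h"
    proof
      fix p :: "int \<times> int" assume "p \<in> {0, 1} \<times> {0, 1}"
      then have "p \<in> {h Zero, h One, h Omega, h OmegaBar}" by (auto simp: h_def)
      then show "p \<in> range h" by blast
    qed
  qed (use h in blast)
  ultimately have "h \<in> iso klein_group (integer_mod_group 2 \<times>\<times> integer_mod_group 2)"
    by (simp add: iso_def bij_betw_def carr klein_group_def)
  then show ?thesis by (rule is_isoI)
qed

definition klein_dot :: "klein \<Rightarrow> klein \<Rightarrow> bit" where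
  "klein_dot x y = (if x \<noteq> y \<and> x \<noteq> Zero \<and> y \<noteq> Zero then 1 else 0)"

text \<open>A word of length \<open>n\<close> is a function on \<open>{..<n}\<close>, extended by \<open>undefined\<close> elsewhere.\<close>

definition klein_power :: "nat \<Rightarrow> (nat \<Rightarrow> klein) monoid" where
  "klein_power n = product_group {..<n} (\<lambda>_. klein_group)"

definition word_dot :: "nat \<Rightarrow> (nat \<Rightarrow> klein) \<Rightarrow> (nat \<Rightarrow> klein) \<Rightarrow> bit" where
  "word_dot n x y = (\<Sum>i<n. klein_dot (x i) (y i))"

definition L_code :: "nat \<Rightarrow> (nat \<Rightarrow> klein) set \<Rightarrow> bool" where
  "L_code n C \<longleftrightarrow> subgroup C (klein_power n)"

definition dual_code :: "nat \<Rightarrow> (nat \<Rightarrow> klein) set \<Rightarrow> (nat \<Rightarrow> klein) set" where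
  "dual_code n C = {x \<in> carrier (klein_power n). \<forall>y\<in>C. word_dot n x y = 0}"

definition self_dual :: "nat \<Rightarrow> (nat \<Rightarrow> klein) set \<Rightarrow> bool" where
  "self_dual n C \<longleftrightarrow> C = dual_code n C"

text \<open>
  Polynomials in three variables are finitely supported maps from monomials to coefficients; a
  monomial is an exponent vector indexed by the three-element type \<open>3\<close>, whose elements are
  \<open>1\<close>, \<open>2\<close> and \<open>3\<close> (the last being equal to \<open>0\<close>). The product of \<open>poly_mapping\<close> is the
  convolution, hence the usual product of polynomials.
\<close>

type_synonym 'k poly3 = "(3 \<Rightarrow>\<^sub>0 nat) \<Rightarrow>\<^sub>0 'k"

definition Var3 :: "3 \<Rightarrow> 'k::comm_ring_1 poly3" where
  "Var3 i = Poly_Mapping.single (Poly_Mapping.single i 1) 1"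

definition Const3 :: "'k::comm_ring_1 \<Rightarrow> 'k poly3" where
  "Const3 a = Poly_Mapping.single 0 a"

definition subst3 ::
  "'k::comm_ring_1 poly3 \<Rightarrow> 'k poly3 \<Rightarrow> 'k poly3 \<Rightarrow> 'k poly3 \<Rightarrow> 'k poly3" where
  "subst3 F p q r =
    (\<Sum>m\<in>Poly_Mapping.keys F. Const3 (Poly_Mapping.lookup F m) *
       p ^ Poly_Mapping.lookup m 1 * q ^ Poly_Mapping.lookup m 2 * r ^ Poly_Mapping.lookup m 3)"

definition weighted_homogeneous ::
  "nat \<Rightarrow> nat \<Rightarrow> nat \<Rightarrow> nat \<Rightarrow> 'k::comm_ring_1 poly3 \<Rightarrow> bool" where
  "weighted_homogeneous w1 w2 w3 d F \<longleftrightarrow>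
    (\<forall>m\<in>Poly_Mapping.keys F.
       w1 * Poly_Mapping.lookup m 1 + w2 * Poly_Mapping.lookup m 2
         + w3 * Poly_Mapping.lookup m 3 = d)"

definition n0 :: "nat \<Rightarrow> (nat \<Rightarrow> klein) \<Rightarrow> nat" where
  "n0 n c = card {i. i < n \<and> c i = Zero}"

definition n1 :: "nat \<Rightarrow> (nat \<Rightarrow> klein) \<Rightarrow> nat" where
  "n1 n c = card {i. i < n \<and> c i = One}"

definition n2 :: "nat \<Rightarrow> (nat \<Rightarrow> klein) \<Rightarrow> nat" where
  "n2 n c = card {i. i < n \<and> (c i = Omega \<or> c i = OmegaBar)}"

definition swe ::
  "nat \<Rightarrow> (nat \<Rightarrow> klein) set \<Rightarrow> 'k::comm_ring_1 poly3 \<Rightarrow> 'k poly3 \<Rightarrow> 'k poly3 \<Rightarrow> 'k poly3" where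
  "swe n C x y z = (\<Sum>c\<in>C. x ^ n0 n c * y ^ n1 n c * z ^ n2 n c)"

end

theory Submission
  imports Defs
begin

text \<open>
  By the MacWilliams identity and \<open>|C| = 2 ^ n\<close>, the enumerator of a self-dual code is invariant
  under the linear substitution \<open>x \<mapsto> (x + y + 2z)/2\<close>, \<open>y \<mapsto> (x + y - 2z)/2\<close>, \<open>z \<mapsto> (x - y)/2\<close>. This
  is a reflection: it fixes \<open>a = x + y\<close> and \<open>b = x + z\<close> and negates \<open>u = x - y - 2z\<close>. Hence the
  enumerator, expanded in \<open>a\<close>, \<open>b\<close>, \<open>u\<close>, has only even powers of \<open>u\<close>, and with
  \<open>q = x\<^sup>2 + y\<^sup>2 + 2z\<^sup>2\<close> we have \<open>u\<^sup>2 = 4q - 3a\<^sup>2 + 4ab - 4b\<^sup>2\<close>.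
\<close>

section \<open>Characters and orthogonality on a code\<close>

text \<open>The nontrivial character of the additive group of F_2. The target ring is left open:
  integers serve for orthogonality, polynomials for enumerators.\<close>

definition bit_sign :: "bit \<Rightarrow> 'a::comm_ring_1" where
  "bit_sign b = (if b = 0 then 1 else - 1)"

lemma bit_sign_add: "bit_sign (a + b) = bit_sign a * bit_sign b"
  by (cases a; cases b) (simp_all add: bit_sign_def)

lemma bit_sign_sum: "finite A \<Longrightarrow> bit_sign (sum f A) = (\<Prod>i\<in>A. bit_sign (f i))"
proof (induction A rule: finite_induct)
  case (insert a A)
  then show ?case by (simp only: sum.insert prod.insert bit_sign_add not_False_eq_True)
qed (simp add: bit_sign_def)

lemma of_int_bit_sign: "of_int (bit_sign b) = bit_sign b"
  by (simp add: bit_sign_def)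

lemma UNIV_klein: "(UNIV :: klein set) = {Zero, One, Omega, OmegaBar}"
  using klein.exhaust by blast

lemma finite_UNIV_klein: "finite (UNIV :: klein set)"
  by (simp add: UNIV_klein)

lemma klein_dot_commute: "klein_dot x y = klein_dot y x"
  by (auto simp: klein_dot_def)

lemma klein_dot_add_left: "klein_dot (klein_add x y) v = klein_dot x v + klein_dot y v"
  by (cases x; cases y; cases v) (simp_all add: klein_dot_def)

lemma carrier_klein_power: "carrier (klein_power n) = {..<n} \<rightarrow>\<^sub>E UNIV"
  by (simp add: klein_power_def klein_group_def)

lemma mult_klein_power:
  "c \<otimes>\<^bsub>klein_power n\<^esub> d = (\<lambda>i\<in>{..<n}. klein_add (c i) (d i))"
  by (simp add: klein_power_def klein_group_def)

lemma group_klein_power: "group (klein_power n)"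
  unfolding klein_power_def
  using comm_group_klein_group by (intro product_group) (auto simp: comm_group_def)

lemma word_dot_mult_left:
  "word_dot n (c \<otimes>\<^bsub>klein_power n\<^esub> d) v = word_dot n c v + word_dot n d v"
  unfolding word_dot_def mult_klein_power sum.distrib[symmetric]
  by (intro sum.cong) (simp_all add: klein_dot_add_left)

lemma word_dot_commute: "word_dot n c d = word_dot n d c"
  by (simp add: word_dot_def klein_dot_commute)

lemma L_code_subset: "L_code n C \<Longrightarrow> C \<subseteq> carrier (klein_power n)"
  by (simp add: L_code_def subgroup.subset)

lemma finite_L_code: "L_code n C \<Longrightarrow> finite C"
  using L_code_subset[of n C] finite_subset
  by (fastforce simp: carrier_klein_power intro: finite_PiE finite_UNIV_klein)

text \<open>If \<open>v\<close> is not in the dual, some \<open>d\<close> in \<open>C\<close> pairs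
  with it to 1. Translation by \<open>d\<close> permutes \<open>C\<close> and flips every sign, so
  the sum equals its own negative and vanishes in the integers.\<close>

lemma character_sum_L_code:
  assumes C: "L_code n C" and v: "v \<in> carrier (klein_power n)"
  shows "(\<Sum>c\<in>C. bit_sign (word_dot n c v)) = (if v \<in> dual_code n C then int (card C) else 0)"
proof (cases "v \<in> dual_code n C")
  case True
  then have "bit_sign (word_dot n c v) = (1::int)" if "c \<in> C" for c
    using that by (simp add: dual_code_def bit_sign_def word_dot_commute)
  with True show ?thesis by simp
next
  case False
  then obtain d where d: "d \<in> C" and "word_dot n d v \<noteq> 0"
    using v by (auto simp: dual_code_def word_dot_commute)
  then have sd: "bit_sign (word_dot n d v) = (- 1 :: int)"
    by (simp add: bit_sign_def)
  interpret G: group "klein_power n" by (rule group_klein_power)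
  have sub: "subgroup C (klein_power n)" using C by (simp add: L_code_def)
  let ?t = "\<lambda>c. d \<otimes>\<^bsub>klein_power n\<^esub> c"
  have inj: "inj_on ?t C"
    using d L_code_subset[OF C] by (auto intro: inj_on_subset[OF G.inj_on_cmult])
  have "?t ` C = C"
    using inj finite_L_code[OF C] subgroup.m_closed[OF sub d]
    by (intro endo_inj_surj) auto
  then have "(\<Sum>c\<in>C. bit_sign (word_dot n c v)) = (\<Sum>c\<in>C. bit_sign (word_dot n (?t c) v) :: int)"
    using sum.reindex[OF inj, of "\<lambda>c. bit_sign (word_dot n c v) :: int"] by simp
  also have "\<dots> = - (\<Sum>c\<in>C. bit_sign (word_dot n c v))"
    by (simp only: word_dot_mult_left bit_sign_add sd mult_minus1 sum_negf)
  finally show ?thesis using False by simp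
qed

section \<open>Enumerators and the MacWilliams identity\<close>

definition complete_enum :: "nat \<Rightarrow> (nat \<Rightarrow> klein) set \<Rightarrow> (klein \<Rightarrow> 'a::comm_ring_1) \<Rightarrow> 'a" where
  "complete_enum n C f = (\<Sum>c\<in>C. \<Prod>i<n. f (c i))"

text \<open>The Fourier transform on the Klein group, which \<open>klein_dot\<close> identifies with
  its own character group.\<close>

definition klein_fourier :: "(klein \<Rightarrow> 'a::comm_ring_1) \<Rightarrow> klein \<Rightarrow> 'a" where
  "klein_fourier f a = (\<Sum>b\<in>UNIV. bit_sign (klein_dot a b) * f b)"

lemma klein_fourier_simps:
  "klein_fourier f Zero = f Zero + f One + f Omega + f OmegaBar"
  "klein_fourier f One = f Zero + f One - f Omega - f OmegaBar"
  "klein_fourier f Omega = f Zero - f One + f Omega - f OmegaBar"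
  "klein_fourier f OmegaBar = f Zero - f One - f Omega + f OmegaBar"
  by (simp_all add: klein_fourier_def UNIV_klein klein_dot_def bit_sign_def)

text \<open>Expanding the product of transforms gives a sum over all words \<open>v\<close>, each
  weighted by a character of \<open>C\<close>. Summing over \<open>C\<close> first leaves only the
  \<open>v\<close> in the dual, by orthogonality.\<close>

lemma macwilliams_identity:
  assumes "L_code n C"
  shows "complete_enum n C (klein_fourier f) = of_nat (card C) * complete_enum n (dual_code n C) f"
proof -
  let ?V = "{..<n} \<rightarrow>\<^sub>E (UNIV :: klein set)"
  have fin: "finite ?V" by (simp add: finite_PiE finite_UNIV_klein)
  have "complete_enum n C (klein_fourier f)
      = (\<Sum>c\<in>C. \<Sum>v\<in>?V. \<Prod>i<n. bit_sign (klein_dot (c i) (v i)) * f (v i))"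
    by (simp add: complete_enum_def klein_fourier_def prod_sum_PiE finite_UNIV_klein)
  also have "\<dots> = (\<Sum>c\<in>C. \<Sum>v\<in>?V. bit_sign (word_dot n c v) * (\<Prod>i<n. f (v i)))"
    by (simp add: prod.distrib word_dot_def bit_sign_sum)
  \<comment> \<open>The signs are collected into an integer sum before being mapped to the ring,
    where a sum equal to its own negative might be nonzero.\<close>
  also have "\<dots> = (\<Sum>v\<in>?V. of_int (\<Sum>c\<in>C. bit_sign (word_dot n c v)) * (\<Prod>i<n. f (v i)))"
    by (subst sum.swap) (simp add: sum_distrib_right of_int_bit_sign)
  also have "\<dots> = (\<Sum>v\<in>?V. if v \<in> dual_code n C then of_nat (card C) * (\<Prod>i<n. f (v i)) else 0)"
    by (intro sum.cong) (simp_all add: character_sum_L_code[OF assms] carrier_klein_power)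
  also have "\<dots> = (\<Sum>v\<in>?V \<inter> dual_code n C. of_nat (card C) * (\<Prod>i<n. f (v i)))"
    by (simp add: sum.inter_restrict[OF fin])
  also have "?V \<inter> dual_code n C = dual_code n C"
    by (auto simp: dual_code_def carrier_klein_power)
  finally show ?thesis by (simp add: complete_enum_def sum_distrib_left)
qed

lemma complete_enum_cmult: "complete_enum n C (\<lambda>a. k * f a) = k ^ n * complete_enum n C f"
  by (simp add: complete_enum_def prod.distrib sum_distrib_left)

text \<open>The all-ones weight transforms to four times the indicator of \<open>Zero\<close>, so the
  MacWilliams identity reads \<open>4 ^ n = |C|\<^sup>2\<close>.\<close>

lemma card_self_dual:
  assumes "L_code n C" "self_dual n C"
  shows "card C = 2 ^ n"
proof -
  let ?e = "(\<lambda>i\<in>{..<n}. Zero)"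
  have dual: "dual_code n C = C" using assms(2) by (simp add: self_dual_def)
  have "?e \<in> C"
    using assms(1) subgroup.one_closed[of C "klein_power n"]
    by (simp add: L_code_def klein_power_def klein_group_def)
  have "complete_enum n C (klein_fourier (\<lambda>_. 1)) = (\<Sum>c\<in>C. if c = ?e then 4 ^ n else 0 :: int)"
    unfolding complete_enum_def
  proof (intro sum.cong refl)
    fix c assume "c \<in> C"
    then have c: "c \<in> {..<n} \<rightarrow>\<^sub>E UNIV"
      using L_code_subset[OF assms(1)] by (auto simp: carrier_klein_power)
    have F: "klein_fourier (\<lambda>_. 1 :: int) a = (if a = Zero then 4 else 0)" for a
      by (cases a) (simp_all add: klein_fourier_simps)
    show "(\<Prod>i<n. klein_fourier (\<lambda>_. 1) (c i)) = (if c = ?e then 4 ^ n else 0 :: int)"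
    proof (cases "c = ?e")
      case False
      then obtain i where "i < n" "c i \<noteq> Zero"
        using PiE_ext[OF c, of ?e] by auto
      then have "(\<Prod>i<n. klein_fourier (\<lambda>_. 1) (c i)) = (0 :: int)"
        by (intro prod_zero) (auto simp: F)
      with False show ?thesis by simp
    qed (simp add: F)
  qed
  also have "\<dots> = 4 ^ n"
    using \<open>?e \<in> C\<close> finite_L_code[OF assms(1)] by simp
  finally have "(4::int) ^ n = int (card C) * int (card C)"
    using macwilliams_identity[OF assms(1), of "\<lambda>_. 1 :: int"]
    by (simp add: dual complete_enum_def)
  then have "int ((card C)\<^sup>2) = int ((2 ^ n)\<^sup>2)"
    by (simp add: power2_eq_square flip: power_mult_distrib)
  then have "(card C)\<^sup>2 = (2 ^ n)\<^sup>2"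
    by (simp only: of_nat_eq_iff)
  then show ?thesis by (metis power2_eq_iff_nonneg zero_le)
qed

lemma complete_enum_fourier_self_dual:
  assumes "L_code n C" "self_dual n C"
  shows "complete_enum n C (klein_fourier f) = 2 ^ n * complete_enum n C f"
  using macwilliams_identity[OF assms(1), of f] card_self_dual[OF assms] assms(2)
  by (simp add: self_dual_def)

lemma swe_eq_complete_enum:
  "swe n C x y z = complete_enum n C (case_klein x y z z)"
  unfolding swe_def complete_enum_def
proof (intro sum.cong refl)
  fix c :: "nat \<Rightarrow> klein"
  define S where "S a = {i. i < n \<and> c i = a}" for a
  have fin: "finite (S a)" for a by (simp add: S_def)
  have P: "(\<Prod>i\<in>S a. case_klein x y z z (c i)) = case_klein x y z z a ^ card (S a)" for a
    by (simp add: S_def)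
  have disj: "S a \<inter> S b = {}" if "a \<noteq> b" for a b
    using that by (auto simp: S_def)
  have "{i. i < n \<and> (c i = Omega \<or> c i = OmegaBar)} = S Omega \<union> S OmegaBar"
    by (auto simp: S_def)
  then have n2: "n2 n c = card (S Omega) + card (S OmegaBar)"
    unfolding n2_def using card_Un_disjoint[OF fin fin disj[of Omega OmegaBar]] by simp
  \<comment> \<open>The coordinates are split into the four fibres of \<open>c\<close>; the last two
    carry the same weight \<open>z\<close>.\<close>
  have un: "{..<n} = S Zero \<union> (S One \<union> (S Omega \<union> S OmegaBar))"
    using klein.exhaust by (auto simp: S_def)
  have "(\<Prod>i<n. case_klein x y z z (c i))
      = x ^ card (S Zero) * (y ^ card (S One) * (z ^ card (S Omega) * z ^ card (S OmegaBar)))"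
    unfolding un by (simp add: prod.union_disjoint fin Int_Un_distrib disj P)
  then show "x ^ n0 n c * y ^ n1 n c * z ^ n2 n c = (\<Prod>i<n. case_klein x y z z (c i))"
    unfolding n2 by (simp add: n0_def n1_def S_def power_add mult.assoc)
qed

section \<open>Substitution as a ring homomorphism\<close>

text \<open>Monomials outside the support contribute zero, so polynomials with different supports
  can be evaluated over a common index set.\<close>

lemma subst3_superset:
  assumes "finite K" "Poly_Mapping.keys F \<subseteq> K"
  shows "subst3 F p q r = (\<Sum>m\<in>K. Const3 (Poly_Mapping.lookup F m) *
    p ^ Poly_Mapping.lookup m 1 * q ^ Poly_Mapping.lookup m 2 * r ^ Poly_Mapping.lookup m 3)"
  unfolding subst3_def
  by (rule sum.mono_neutral_left[OF assms]) (simp add: in_keys_iff Const3_def)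

lemma Const3_add: "Const3 (a + b) = Const3 a + Const3 b"
  by (simp add: Const3_def single_add)

lemma Const3_mult: "Const3 (a * b) = Const3 a * Const3 b"
  by (simp add: Const3_def mult_single)

lemma subst3_add: "subst3 (F + G) p q r = subst3 F p q r + subst3 G p q r"
proof -
  let ?K = "Poly_Mapping.keys F \<union> Poly_Mapping.keys G"
  have "Poly_Mapping.keys (F + G) \<subseteq> ?K" by (rule Poly_Mapping.keys_add)
  then show ?thesis
    by (simp add: subst3_superset[of ?K] lookup_add Const3_add distrib_right sum.distrib)
qed

lemma subst3_single:
  "subst3 (Poly_Mapping.single m k) p q r = Const3 k *
    p ^ Poly_Mapping.lookup m 1 * q ^ Poly_Mapping.lookup m 2 * r ^ Poly_Mapping.lookup m 3"
  by (simp add: subst3_superset[of "{m}"])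

lemma poly_mapping_add_single_induct [case_names zero add_single]:
  assumes zero: "P 0"
    and add_single: "\<And>f m k. P f \<Longrightarrow> P (f + Poly_Mapping.single m k)"
  shows "P (F :: 'a \<Rightarrow>\<^sub>0 'b::comm_monoid_add)"
proof (induction F rule: update_induct)
  case (update f m k)
  have "Poly_Mapping.update m k f = f + Poly_Mapping.single m k"
    using update.hyps(1)
    by (intro poly_mapping_eqI) (auto simp: lookup_update lookup_add lookup_single in_keys_iff)
  then show ?case using add_single[OF update.IH] by simp
qed (rule zero)

lemma subst3_0: "subst3 0 p q r = 0"
  by (simp add: subst3_def)

text \<open>Both sides are additive in each factor, so two inductions reduce the claim to a product
  of two monomials, where exponents add.\<close>

lemma subst3_mult: "subst3 (F * G) p q r = subst3 F p q r * subst3 G p q r"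
proof (induction F rule: poly_mapping_add_single_induct)
  case (add_single F m k)
  have "subst3 (Poly_Mapping.single m k * G) p q r
      = subst3 (Poly_Mapping.single m k) p q r * subst3 G p q r"
  proof (induction G rule: poly_mapping_add_single_induct)
    case (add_single G m' k')
    then show ?case
      by (simp add: distrib_left subst3_add)
        (simp add: mult_single subst3_single Const3_mult lookup_add power_add ac_simps)
  qed (simp add: subst3_0)
  with add_single.IH show ?case
    by (simp add: distrib_right subst3_add)
qed (simp add: subst3_0)

section \<open>Values of weighted homogeneous polynomials\<close>

text \<open>The image under substitution of the degree \<open>d\<close> component of the polynomial
  ring graded by 1, 1, 2. Its closure properties allow degrees to be tracked on values, without
  exhibiting \<open>F\<close>.\<close>

definition graded_subst ::
  "'k::comm_ring_1 poly3 \<Rightarrow> 'k poly3 \<Rightarrow> 'k poly3 \<Rightarrow> nat \<Rightarrow> 'k poly3 \<Rightarrow> bool" where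
  "graded_subst p q r d P \<longleftrightarrow> (\<exists>F. weighted_homogeneous 1 1 2 d F \<and> P = subst3 F p q r)"

lemma graded_subst_single:
  fixes m :: "3 \<Rightarrow>\<^sub>0 nat"
  assumes "Poly_Mapping.lookup m 1 + Poly_Mapping.lookup m 2 + 2 * Poly_Mapping.lookup m 3 = d"
  shows "graded_subst p q r d (Const3 k *
    p ^ Poly_Mapping.lookup m 1 * q ^ Poly_Mapping.lookup m 2 * r ^ Poly_Mapping.lookup m 3)"
  unfolding graded_subst_def
  by (rule exI[of _ "Poly_Mapping.single m k"])
    (use assms in \<open>simp add: subst3_single weighted_homogeneous_def\<close>)

lemma graded_subst_const: "graded_subst p q r 0 (Const3 k)"
  using graded_subst_single[of 0 0] by simp

lemma graded_subst_0: "graded_subst p q r d 0"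
  unfolding graded_subst_def
  by (rule exI[of _ 0]) (simp add: subst3_def weighted_homogeneous_def)

lemma graded_subst_vars:
  "graded_subst p q r 1 p" "graded_subst p q r 1 q" "graded_subst p q r 2 r"
  using graded_subst_single[of "Poly_Mapping.single (1::3) 1" 1 p q r 1]
    graded_subst_single[of "Poly_Mapping.single (2::3) 1" 1 p q r 1]
    graded_subst_single[of "Poly_Mapping.single (3::3) 1" 2 p q r 1]
  by (simp_all add: lookup_single Const3_def)

lemma graded_subst_add:
  assumes "graded_subst p q r d P" "graded_subst p q r d Q"
  shows "graded_subst p q r d (P + Q)"
proof -
  obtain F G where "weighted_homogeneous 1 1 2 d F" "P = subst3 F p q r"
    "weighted_homogeneous 1 1 2 d G" "Q = subst3 G p q r"
    using assms by (auto simp: graded_subst_def)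
  then show ?thesis
    unfolding graded_subst_def weighted_homogeneous_def
    using Poly_Mapping.keys_add[of F G]
    by (intro exI[of _ "F + G"]) (auto simp: subst3_add)
qed

lemma graded_subst_mult:
  assumes "graded_subst p q r d P" "graded_subst p q r e Q"
  shows "graded_subst p q r (d + e) (P * Q)"
proof -
  obtain F G where "weighted_homogeneous 1 1 2 d F" "P = subst3 F p q r"
    "weighted_homogeneous 1 1 2 e G" "Q = subst3 G p q r"
    using assms by (auto simp: graded_subst_def)
  then show ?thesis
    unfolding graded_subst_def weighted_homogeneous_def
    using keys_mult[of F G]
    by (intro exI[of _ "F * G"]) (fastforce simp: subst3_mult lookup_add)
qed

lemma graded_subst_cmult: "graded_subst p q r d P \<Longrightarrow> graded_subst p q r d (Const3 k * P)"
  using graded_subst_mult[OF graded_subst_const] by fastforce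

lemma graded_subst_sum:
  "(\<And>i. i \<in> A \<Longrightarrow> graded_subst p q r d (f i)) \<Longrightarrow> graded_subst p q r d (sum f A)"
  by (induction A rule: infinite_finite_induct) (auto intro: graded_subst_0 graded_subst_add)

lemma Const3_of_int: "Const3 (of_int k) = of_int k"
  by (simp add: Const3_def)

lemma graded_subst_of_int_mult:
  "graded_subst p q r d P \<Longrightarrow> graded_subst p q r d (of_int k * P)"
  using graded_subst_cmult[of p q r d P "of_int k"] by (simp add: Const3_of_int)

section \<open>Even and odd parts in u, and the conclusion\<close>

text \<open>The two products are exchanged by changing the sign of \<open>u\<close>, so they share
  the even part \<open>A\<close> and differ in the sign of the odd part. Only the square of
  \<open>u\<close> is assumed to be graded, hence the factor \<open>u\<close> is kept apart from
  \<open>B\<close>.\<close>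

lemma prod_even_odd_parts:
  assumes "graded_subst p q r 2 (u\<^sup>2)"
    and "\<And>i. i < n \<Longrightarrow> graded_subst p q r 1 (s i)"
  shows "\<exists>A B. graded_subst p q r n A \<and> (if n = 0 then B = 0 else graded_subst p q r (n - 1) B) \<and>
    (\<Prod>i<n. s i + of_int (k i) * u) = A + u * B \<and> (\<Prod>i<n. s i - of_int (k i) * u) = A - u * B"
  using assms(2)
proof (induction n)
  case 0
  show ?case
    using graded_subst_const[of p q r 1] by (intro exI[of _ 1] exI[of _ 0]) (simp add: Const3_def)
next
  case (Suc n)
  then obtain A B where A: "graded_subst p q r n A"
    and B: "if n = 0 then B = 0 else graded_subst p q r (n - 1) B"
    and P: "(\<Prod>i<n. s i + of_int (k i) * u) = A + u * B"
      "(\<Prod>i<n. s i - of_int (k i) * u) = A - u * B"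
    by fastforce
  have s: "graded_subst p q r 1 (s n)" using Suc.prems by simp
  \<comment> \<open>These are the even and odd parts of (A + u B)(s + k u), with u^2 absorbed into
    the even part.\<close>
  let ?A = "A * s n + of_int (k n) * (B * u\<^sup>2)" and ?B = "of_int (k n) * A + B * s n"
  \<comment> \<open>For \<open>n = 0\<close> the truncated degree \<open>n - 1\<close> would be off
    by one; there \<open>B\<close> is 0, which lies in every degree.\<close>
  have Bu: "graded_subst p q r (Suc n) (B * u\<^sup>2)"
    using B graded_subst_mult[OF _ assms(1), of "n - 1" B] graded_subst_0[of p q r]
    by (cases n) (simp_all split: if_splits)
  have Bs: "graded_subst p q r n (B * s n)"
    using B graded_subst_mult[OF _ s, of "n - 1" B] graded_subst_0[of p q r]
    by (cases n) (simp_all split: if_splits)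
  have "graded_subst p q r (Suc n) ?A"
    using graded_subst_mult[OF A s] Bu by (auto intro: graded_subst_add graded_subst_of_int_mult)
  moreover have "graded_subst p q r n ?B"
    using A Bs by (auto intro: graded_subst_add graded_subst_of_int_mult)
  moreover have "(\<Prod>i<Suc n. s i + of_int (k i) * u) = ?A + u * ?B"
    "(\<Prod>i<Suc n. s i - of_int (k i) * u) = ?A - u * ?B"
    by (simp_all only: prod.lessThan_Suc P) (simp_all add: power2_eq_square algebra_simps)
  ultimately have "graded_subst p q r (Suc n) ?A \<and>
    (if Suc n = 0 then ?B = 0 else graded_subst p q r (Suc n - 1) ?B) \<and>
    (\<Prod>i<Suc n. s i + of_int (k i) * u) = ?A + u * ?B \<and>
    (\<Prod>i<Suc n. s i - of_int (k i) * u) = ?A - u * ?B"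
    by (simp only: nat.distinct if_False diff_Suc_1 simp_thms)
  then show ?case by blast
qed

theorem theorem4p5:
  fixes n :: nat and C :: "(nat \<Rightarrow> klein) set" and x y z :: "'k::field_char_0 poly3"
  defines "x \<equiv> Var3 1" and "y \<equiv> Var3 2" and "z \<equiv> Var3 3"
  assumes "L_code n C" and "self_dual n C"
  shows "\<exists>F :: 'k poly3. weighted_homogeneous 1 1 2 n F \<and>
           swe n C x y z = subst3 F (x + y) (x + z) (x\<^sup>2 + y\<^sup>2 + 2 * z\<^sup>2)"
proof -
  define a b q u where "a = x + y" and "b = x + z" and "q = x\<^sup>2 + y\<^sup>2 + 2 * z\<^sup>2"
    and "u = x - y - 2 * z"
  let ?S = "graded_subst a b q"
  note S = graded_subst_vars[of a b q] graded_subst_add graded_subst_of_int_mult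
  define f where "f = case_klein x y z z"
  \<comment> \<open>Solving for the variables gives 4x = a + 2b + u, 4y = 3a - 2b - u and 4z = -a +
    2b - u; \<open>s\<close> is the part in \<open>a\<close>, \<open>b\<close>, and \<open>k\<close>
    the coefficient of \<open>u\<close>. Scalars are written with \<open>of_int\<close> to match the
    closure rules.\<close>
  define s where "s = case_klein (a + of_int 2 * b) (of_int 3 * a + of_int (- 2) * b)
    (of_int 2 * b + of_int (- 1) * a) (of_int 2 * b + of_int (- 1) * a)"
  define k :: "klein \<Rightarrow> int" where "k = case_klein 1 (- 1) (- 1) (- 1)"
  have s: "?S 1 (s c)" for c
    unfolding s_def by (cases c; simp only: klein.case; intro S)
  have f4: "4 * f c = s c + of_int (k c) * u" for c
    by (cases c) (simp_all add: f_def s_def k_def a_def b_def u_def algebra_simps)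
  \<comment> \<open>The transform is twice the reflection, so doubling it gives the expansion of
    \<open>4 * f c\<close> with \<open>u\<close> negated.\<close>
  have fourier: "2 * klein_fourier f c = s c - of_int (k c) * u" for c
    by (cases c)
      (simp_all add: klein_fourier_simps f_def s_def k_def a_def b_def u_def algebra_simps)
  have "u\<^sup>2 = of_int 4 * q + of_int (- 3) * (a * a) + of_int 4 * (a * b) + of_int (- 4) * (b * b)"
    by (simp add: u_def q_def a_def b_def power2_eq_square algebra_simps)
  moreover have "?S 2 (a * a)" "?S 2 (a * b)" "?S 2 (b * b)"
    using graded_subst_mult[of a b q 1 _ 1] graded_subst_vars[of a b q]
    by (metis one_add_one)+
  ultimately have "?S 2 (u\<^sup>2)"
    by (simp only: graded_subst_vars graded_subst_add graded_subst_of_int_mult)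
  then have "\<exists>A B. ?S n A \<and> (\<Prod>i<n. 4 * f (c i)) = A + u * B
      \<and> (\<Prod>i<n. 2 * klein_fourier f (c i)) = A - u * B" for c :: "nat \<Rightarrow> klein"
    unfolding f4 fourier
    using prod_even_odd_parts[of a b q u n "\<lambda>i. s (c i)" "\<lambda>i. k (c i)"] s by blast
  then obtain A B where A: "\<And>c. ?S n (A c)"
    and AB: "\<And>c. (\<Prod>i<n. 4 * f (c i)) = A c + u * B c"
      "\<And>c. (\<Prod>i<n. 2 * klein_fourier f (c i)) = A c - u * B c"
    by metis
  \<comment> \<open>Adding the two products word by word cancels the odd parts.\<close>
  have "4 ^ n * complete_enum n C f + 2 ^ n * complete_enum n C (klein_fourier f) = 2 * sum A C"
    unfolding complete_enum_cmult[symmetric]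
    by (simp add: complete_enum_def AB sum.distrib sum_subtractf)
  \<comment> \<open>By self-duality the second summand contributes 2^n times 2^n copies of the
    enumerator, as many as the first.\<close>
  then have "of_int (2 * 4 ^ n) * complete_enum n C f = of_int 2 * sum A C"
    by (simp add: complete_enum_fourier_self_dual[OF assms(4,5)] ac_simps
        flip: power_mult_distrib)
  \<comment> \<open>In characteristic zero 2 * 4^n is invertible in the field; viewing it as a
    constant polynomial lets it be cancelled.\<close>
  then have "Const3 (1 / of_int (2 * 4 ^ n)) * (Const3 (of_int (2 * 4 ^ n)) * complete_enum n C f)
      = Const3 (1 / of_int (2 * 4 ^ n)) * (of_int 2 * sum A C)"
    by (simp only: Const3_of_int)
  then have "complete_enum n C f = Const3 (1 / of_int (2 * 4 ^ n)) * (of_int 2 * sum A C)"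
    by (simp add: mult.assoc[symmetric] flip: Const3_mult) (simp add: Const3_def)
  moreover have "?S n (Const3 (1 / of_int (2 * 4 ^ n)) * (of_int 2 * sum A C))"
    by (intro graded_subst_cmult graded_subst_of_int_mult graded_subst_sum A)
  ultimately show ?thesis
    by (simp add: swe_eq_complete_enum graded_subst_def f_def a_def b_def q_def)
qed

end
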